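(* Let $1<p<\infty$ and let $X$ be either $\ell^p(\mathbb{R}^n)$ or $L^p(M,\mu)$. Let $f:X\to X$ be Lipschitz continuous with constant $L$, and let $x$ be a non-constant $T$-periodic solution of $\dot x=f(x)$ in $X$. Then $$TL\ge C_p^{-1},\qquad\text{where } C_p=\frac{p}{4(p-1)^{1/p}\int_0^1 t^{-1/p}(1-t)^{1/p-1}\,{\rm d}t}.$$
   Context: $\ell^p(\mathbb{R}^n)$ denotes $\mathbb{R}^n$ with the norm $\|(x_1,\dots,x_n)\|=(\sum_j |x_j|^p)^{1/p}$; $L^p(M,\mu)$ is the usual Lebesgue space over a measure space $(M,\mu)$. Lipschitz continuity means $\|f(x)-f(y)\|_X\le L\|x-y\|_X$ for all $x,y\in X$. *)

theory Defs
  imports "HOL-Analysis.Analysis"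
begin

definition Cp :: "real \<Rightarrow> real" where
  "Cp p = p / (4 * (p - 1) powr (1 / p) *
      integral {0..1} (\<lambda>t. t powr (- 1 / p) * (1 - t) powr (1 / p - 1)))"

definition ellp_norm :: "real \<Rightarrow> real ^ 'n \<Rightarrow> real" where
  "ellp_norm p v = (\<Sum>i\<in>UNIV. \<bar>v $ i\<bar> powr p) powr (1 / p)"

definition ellp_has_derivative :: "real \<Rightarrow> (real \<Rightarrow> real ^ 'n) \<Rightarrow> real ^ 'n \<Rightarrow> real \<Rightarrow> bool" where
  "ellp_has_derivative p x v t \<longleftrightarrow>
     ((\<lambda>h. ellp_norm p ((1 / h) *\<^sub>R (x (t + h) - x t) - v)) \<longlongrightarrow> 0) (at 0)"

definition ellp_lipschitz :: "real \<Rightarrow> (real ^ 'n \<Rightarrow> real ^ 'n) \<Rightarrow> real \<Rightarrow> bool" where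
  "ellp_lipschitz p f L \<longleftrightarrow> (\<forall>u v. ellp_norm p (f u - f v) \<le> L * ellp_norm p (u - v))"

text \<open>Elements of L^p are represented by measurable functions with finite p-th moment;
  equality in L^p is equality almost everywhere, i.e. vanishing of the L^p distance.\<close>

definition Lp_set :: "real \<Rightarrow> 'a measure \<Rightarrow> ('a \<Rightarrow> real) set" where
  "Lp_set p M = {g. g \<in> borel_measurable M \<and> (\<integral>\<^sup>+ w. ennreal (\<bar>g w\<bar> powr p) \<partial>M) < \<infinity>}"

definition Lp_norm :: "real \<Rightarrow> 'a measure \<Rightarrow> ('a \<Rightarrow> real) \<Rightarrow> real" where
  "Lp_norm p M g = enn2real (\<integral>\<^sup>+ w. ennreal (\<bar>g w\<bar> powr p) \<partial>M) powr (1 / p)"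

definition Lp_has_derivative ::
  "real \<Rightarrow> 'a measure \<Rightarrow> (real \<Rightarrow> 'a \<Rightarrow> real) \<Rightarrow> ('a \<Rightarrow> real) \<Rightarrow> real \<Rightarrow> bool" where
  "Lp_has_derivative p M x v t \<longleftrightarrow>
     ((\<lambda>h. Lp_norm p M (\<lambda>w. (x (t + h) w - x t w) / h - v w)) \<longlongrightarrow> 0) (at 0)"

definition Lp_lipschitz ::
  "real \<Rightarrow> 'a measure \<Rightarrow> (('a \<Rightarrow> real) \<Rightarrow> ('a \<Rightarrow> real)) \<Rightarrow> real \<Rightarrow> bool" where
  "Lp_lipschitz p M f L \<longleftrightarrow>
     (\<forall>u\<in>Lp_set p M. f u \<in> Lp_set p M) \<and>
     (\<forall>u\<in>Lp_set p M. \<forall>v\<in>Lp_set p M.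
        Lp_norm p M (\<lambda>w. f u w - f v w) \<le> L * Lp_norm p M (\<lambda>w. u w - v w))"

end

theory Submission
  imports Defs
begin

text \<open>
  Put \<open>S = T / 2\<close> and \<open>y(t) = x(t + S) - x(t)\<close>. Then \<open>\<parallel>y'\<parallel> \<le> L \<parallel>y\<parallel>\<close> and \<open>y\<close> is antiperiodic,
  \<open>y(t + S) = - y(t)\<close>, so every component of \<open>y\<close> has a zero, and between two consecutive
  zeros at distance \<open>S\<close> the sharp one-dimensional Dirichlet inequality
  \<open>\<integral>|u|\<^sup>p \<le> (2 C\<^sub>p S)\<^sup>p \<integral>|u'|\<^sup>p\<close> applies; summing over components gives \<open>2 C\<^sub>p S L \<ge> 1\<close>.
  If \<open>y\<close> vanishes identically, halve \<open>T\<close> and repeat; this stops, for otherwise \<open>x' = 0\<close>.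

  The Dirichlet inequality follows from Young's inequality applied to the derivative of
  \<open>w |u|\<^sup>p\<close>, where \<open>w' = - \<lambda> - (p - 1) |w|\<^bsup>p/(p-1)\<^esup>\<close>. A solution \<open>w\<close> exists on an interval of
  length \<open>S\<close> whenever \<open>\<lambda> < (2 C\<^sub>p S)\<^bsup>-p\<^esup>\<close>:
  up to a constant factor its maximal lifetime is the Beta integral in \<open>C\<^sub>p\<close>.
  In \<open>L\<^sup>p\<close> all of this is done on a time grid, so that only finite sums of functions are
  integrated over the measure space.
\<close>

section \<open>The Riccati equation\<close>

text \<open>Since \<open>p > 1\<close>, the difference quotient at 0 has size
  \<open>|h| powr (p - 1)\<close> and tends to 0. One formula therefore covers all points, including
  the zeros of the interpolation used below.\<close>

lemma has_real_derivative_abs_powr: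
  fixes p x :: real
  assumes "1 < p"
  shows "((\<lambda>x. \<bar>x\<bar> powr p) has_real_derivative p * \<bar>x\<bar> powr (p - 1) * sgn x) (at x)"
proof (cases x "0 :: real" rule: linorder_cases)
  case greater
  have "((\<lambda>x. x powr p) has_real_derivative p * \<bar>x\<bar> powr (p - 1) * sgn x) (at x)"
    using has_real_derivative_powr[OF greater, of p] greater by simp
  then show ?thesis
    by (rule has_field_derivative_transform_within_open[where S = "{0<..}"]) (use greater in auto)
next
  case less
  have "((\<lambda>x. (- x) powr p) has_real_derivative p * \<bar>x\<bar> powr (p - 1) * sgn x) (at x)"
    using less by (auto intro!: derivative_eq_intros simp: powr_diff)
  then show ?thesis
    by (rule has_field_derivative_transform_within_open[where S = "{..<0}"]) (use less in auto)
next
  case equal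
  have "((\<lambda>h. \<bar>h\<bar> powr (p - 1)) \<longlongrightarrow> \<bar>0::real\<bar> powr (p - 1)) (at 0)"
    using assms by (intro tendsto_powr' tendsto_intros) auto
  then have lim: "((\<lambda>h::real. \<bar>h\<bar> powr (p - 1)) \<longlongrightarrow> 0) (at 0)"
    by simp
  have "((\<lambda>h::real. \<bar>h\<bar> powr p / h) \<longlongrightarrow> 0) (at 0)"
  proof (rule Lim_null_comparison[OF _ lim])
    show "\<forall>\<^sub>F h in at (0::real). norm (\<bar>h\<bar> powr p / h) \<le> \<bar>h\<bar> powr (p - 1)"
      by (auto simp: eventually_at_filter powr_diff abs_divide)
  qed
  then show ?thesis
    using equal by (simp add: DERIV_def)
qed

text \<open>Convexity of the power, applied to \<open>x + y\<close> written as the mean of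
  \<open>x / (1 - \<theta>)\<close> and \<open>y / \<theta>\<close>. A free \<open>\<theta>\<close>
  keeps the coefficient of \<open>x\<close> near 1 in the Riccati estimate;
  \<open>\<theta> = b / (a + b)\<close> later yields Minkowski's inequality.\<close>

lemma powr_add_le_weighted:
  fixes p x y \<theta> :: real
  assumes "1 < p" "0 \<le> x" "0 \<le> y" "0 < \<theta>" "\<theta> < 1"
  shows "(x + y) powr p \<le> (1 - \<theta>) powr (1 - p) * x powr p + \<theta> powr (1 - p) * y powr p"
proof -
  have pos: "(x + y) powr p \<le> (1 - \<theta>) powr (1 - p) * x powr p + \<theta> powr (1 - p) * y powr p"
    if "0 < x" "0 < y" for x y
  proof -
    have "((1 - \<theta>) * (x / (1 - \<theta>)) + \<theta> * (y / \<theta>)) powr p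
        \<le> (1 - \<theta>) * (x / (1 - \<theta>)) powr p + \<theta> * (y / \<theta>) powr p"
      using convex_onD[OF powr_convex[of p], of \<theta> "x / (1 - \<theta>)" "y / \<theta>"] assms that by simp
    then show ?thesis
      using assms that by (simp add: powr_divide powr_diff)
  qed
  have one: "1 \<le> c powr (1 - p)" if "0 < c" "c < 1" for c
  proof -
    have "c powr (p - 1) \<le> 1 powr (p - 1)"
      using that assms by (intro powr_mono2) auto
    moreover have "c powr (1 - p) = 1 / c powr (p - 1)"
      using that by (simp add: powr_diff)
    ultimately show ?thesis using that by simp
  qed
  have "z powr p \<le> c powr (1 - p) * z powr p" if "0 < c" "c < 1" for c z :: real
    using mult_right_mono[OF one[OF that], of "z powr p"] by simp
  from this[of "1 - \<theta>" x] this[of \<theta> y] pos[of x y] assms show ?thesis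
    by (cases "x = 0"; cases "y = 0") auto
qed

text \<open>Young's inequality for the factors \<open>|D|\<close> and
  \<open>|w| * |v| powr (p - 1)\<close>; the conjugate exponent \<open>q\<close> satisfies
  \<open>(p - 1) * q = p\<close>. The last term is the one that the Riccati equation is designed to
  absorb.\<close>

lemma Young_abs_powr:
  fixes p D w v :: real
  assumes "1 < p"
  shows "p * (\<bar>w\<bar> * \<bar>v\<bar> powr (p - 1) * \<bar>D\<bar>)
           \<le> \<bar>D\<bar> powr p + (p - 1) * \<bar>w\<bar> powr (p / (p - 1)) * \<bar>v\<bar> powr p"
proof -
  define q where "q = p / (p - 1)"
  have q: "q > 1" "1 / p + 1 / q = 1"
    using assms by (auto simp: q_def divide_simps)
  have "\<bar>D\<bar> * (\<bar>w\<bar> * \<bar>v\<bar> powr (p - 1)) \<le> \<bar>D\<bar> powr p / p + (\<bar>w\<bar> * \<bar>v\<bar> powr (p - 1)) powr q / q"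
    by (rule Youngs_inequality) (use assms q in auto)
  also have "(\<bar>w\<bar> * \<bar>v\<bar> powr (p - 1)) powr q = \<bar>w\<bar> powr q * \<bar>v\<bar> powr p"
    using assms by (simp add: powr_mult powr_powr q_def)
  finally have "p * (\<bar>D\<bar> * (\<bar>w\<bar> * \<bar>v\<bar> powr (p - 1)))
      \<le> p * (\<bar>D\<bar> powr p / p + \<bar>w\<bar> powr q * \<bar>v\<bar> powr p / q)"
    using assms by (intro mult_left_mono) auto
  also have "\<dots> = \<bar>D\<bar> powr p + (p - 1) * \<bar>w\<bar> powr q * \<bar>v\<bar> powr p"
    using assms by (simp add: q_def field_simps)
  finally show ?thesis by (simp add: q_def mult_ac)
qed

text \<open>The step from \<open>a\<close> to \<open>b\<close> is followed along the linear interpolation. The weight \<open>\<theta>\<close> pays for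
  replacing the interpolated value by \<open>a\<close>.\<close>

lemma Riccati_step:
  fixes p lam \<theta> a b c \<sigma> \<tau> :: real and w :: "real \<Rightarrow> real"
  assumes p: "1 < p" and lam: "0 \<le> lam" and \<theta>: "0 < \<theta>" "\<theta> < 1"
    and st: "0 \<le> \<sigma>" "\<sigma> \<le> \<tau>" "\<tau> \<le> 1"
    and w: "\<And>s. c + \<sigma> \<le> s \<Longrightarrow> s \<le> c + \<tau> \<Longrightarrow>
      (w has_real_derivative - (lam + (p - 1) * \<bar>w s\<bar> powr (p / (p - 1)))) (at s)"
  shows "w (c + \<tau>) * \<bar>a + \<tau> * (b - a)\<bar> powr p - w (c + \<sigma>) * \<bar>a + \<sigma> * (b - a)\<bar> powr p
    \<le> (\<tau> - \<sigma>) * ((1 + lam * \<theta> powr (1 - p)) * \<bar>b - a\<bar> powr p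
                  - lam * (1 - \<theta>) powr (p - 1) * \<bar>a\<bar> powr p)"
proof -
  define D where "D = b - a"
  define K where "K = (1 + lam * \<theta> powr (1 - p)) * \<bar>D\<bar> powr p - lam * (1 - \<theta>) powr (p - 1) * \<bar>a\<bar> powr p"
  \<comment> \<open>Subtracting \<open>s * K\<close> turns the claim into monotonicity of
    \<open>G\<close>, which is read off from the sign of its derivative.\<close>
  define G where "G s = w (c + s) * \<bar>a + s * D\<bar> powr p - s * K" for s
  have "G \<tau> \<le> G \<sigma>"
  proof (rule DERIV_nonpos_imp_nonincreasing[OF st(2)])
    fix s assume s: "\<sigma> \<le> s" "s \<le> \<tau>"
    define v where "v = a + s * D"
    define W where "W = w (c + s)"
    define G' where "G' = - (lam + (p - 1) * \<bar>W\<bar> powr (p / (p - 1))) * \<bar>v\<bar> powr p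
        + W * (p * \<bar>v\<bar> powr (p - 1) * sgn v * D) - K"
    have 1: "((\<lambda>s. w (c + s)) has_real_derivative - (lam + (p - 1) * \<bar>W\<bar> powr (p / (p - 1)))) (at s)"
      using w[of "c + s"] s unfolding W_def
      by (subst add.commute, subst DERIV_shift[symmetric]) (simp add: add.commute)
    have 2: "((\<lambda>s. \<bar>a + s * D\<bar> powr p) has_real_derivative p * \<bar>v\<bar> powr (p - 1) * sgn v * D) (at s)"
      unfolding v_def
      by (rule DERIV_chain2[OF has_real_derivative_abs_powr[OF p], of "\<lambda>s. a + s * D"])
         (auto intro!: derivative_eq_intros)
    have "(G has_real_derivative G') (at s)"
      unfolding G_def [abs_def] G'_def
      by (rule derivative_eq_intros 1 2 refl | simp add: W_def v_def algebra_simps)+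
    moreover have "G' \<le> 0"
    proof -
      have "W * (p * \<bar>v\<bar> powr (p - 1) * sgn v * D) \<le> \<bar>W * (p * \<bar>v\<bar> powr (p - 1) * sgn v * D)\<bar>"
        by simp
      also have "\<dots> \<le> p * (\<bar>W\<bar> * \<bar>v\<bar> powr (p - 1) * \<bar>D\<bar>)"
        using p by (auto simp: abs_mult sgn_real_def)
      \<comment> \<open>The second term cancels the nonlinear part of the derivative of
        \<open>w\<close> inside \<open>G'\<close>.\<close>
      also have "\<dots> \<le> \<bar>D\<bar> powr p + (p - 1) * \<bar>W\<bar> powr (p / (p - 1)) * \<bar>v\<bar> powr p"
        by (rule Young_abs_powr[OF p])
      finally have A: "G' \<le> \<bar>D\<bar> powr p - lam * \<bar>v\<bar> powr p - K"
        unfolding G'_def by (simp add: algebra_simps)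
      \<comment> \<open>The interpolated value \<open>v\<close> differs from \<open>a\<close> by at
        most \<open>|D|\<close>, so \<open>|v| powr p\<close> can be bounded below by
        \<open>|a| powr p\<close> at the price of a multiple of \<open>|D| powr p\<close>.\<close>
      have "\<bar>s * D\<bar> \<le> \<bar>D\<bar>"
        using s st by (auto simp: abs_mult intro: mult_left_le_one_le)
      then have "\<bar>a\<bar> \<le> \<bar>v\<bar> + \<bar>D\<bar>"
        unfolding v_def by linarith
      then have "\<bar>a\<bar> powr p \<le> (\<bar>v\<bar> + \<bar>D\<bar>) powr p"
        using p by (intro powr_mono2) auto
      also have "\<dots> \<le> (1 - \<theta>) powr (1 - p) * \<bar>v\<bar> powr p + \<theta> powr (1 - p) * \<bar>D\<bar> powr p"
        by (rule powr_add_le_weighted) (use p \<theta> in auto)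
      finally have "(1 - \<theta>) powr (p - 1) * \<bar>a\<bar> powr p \<le> (1 - \<theta>) powr (p - 1) *
          ((1 - \<theta>) powr (1 - p) * \<bar>v\<bar> powr p + \<theta> powr (1 - p) * \<bar>D\<bar> powr p)"
        by (intro mult_left_mono) auto
      also have "\<dots> = \<bar>v\<bar> powr p + (1 - \<theta>) powr (p - 1) * (\<theta> powr (1 - p) * \<bar>D\<bar> powr p)"
        using \<theta> by (simp add: distrib_left powr_diff)
      also have "\<dots> \<le> \<bar>v\<bar> powr p + 1 * (\<theta> powr (1 - p) * \<bar>D\<bar> powr p)"
        using \<theta> p powr_mono2[of "p - 1" "1 - \<theta>" 1]
        by (intro add_left_mono mult_right_mono) auto
      finally have "lam * ((1 - \<theta>) powr (p - 1) * \<bar>a\<bar> powr p)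
          \<le> lam * (\<bar>v\<bar> powr p + \<theta> powr (1 - p) * \<bar>D\<bar> powr p)"
        using lam by (intro mult_left_mono) auto
      with A show ?thesis unfolding K_def by (simp add: algebra_simps)
    qed
    ultimately show "\<exists>y. (G has_real_derivative y) (at s) \<and> y \<le> 0" by blast
  qed
  then show ?thesis by (simp add: G_def K_def D_def algebra_simps)
qed

section \<open>Summation of the Riccati estimate around the period\<close>

text \<open>Antiperiodicity forces a sign change, hence a zero of the piecewise linear
  interpolation. Starting there, the step estimates telescope once around the period, and the
  boundary terms vanish because the interpolation does.\<close>

lemma Riccati_discrete_inequality:
  fixes p lam \<theta> :: real and u :: "nat \<Rightarrow> real" and w :: "real \<Rightarrow> real"
  assumes p: "1 < p" and lam: "0 \<le> lam" and \<theta>: "0 < \<theta>" "\<theta> < 1"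
    and w: "\<And>s. 0 \<le> s \<Longrightarrow> s \<le> real N \<Longrightarrow>
      (w has_real_derivative - (lam + (p - 1) * \<bar>w s\<bar> powr (p / (p - 1)))) (at s)"
    and N: "0 < N" and anti: "u N = - u 0"
  shows "lam * (1 - \<theta>) powr (p - 1) * (\<Sum>j<N. \<bar>u j\<bar> powr p)
    \<le> (1 + lam * \<theta> powr (1 - p)) * (\<Sum>j<N. \<bar>u (Suc j) - u j\<bar> powr p)"
proof -
  \<comment> \<open>Otherwise all \<open>u j\<close> with \<open>j \<le> N\<close> have the strict
    sign of \<open>u 0\<close>, against \<open>u N = - u 0\<close>.\<close>
  have "\<exists>k<N. u k * u (Suc k) \<le> 0"
  proof (rule ccontr)
    assume neg: "\<not> ?thesis"
    have "j \<le> N \<Longrightarrow> 0 < u 0 * u j" for j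
    proof (induction j)
      case 0
      from neg N have "u 0 \<noteq> 0" by auto
      then show ?case by (auto simp: zero_less_mult_iff)
    next
      case (Suc j)
      then have "0 < u 0 * u j" "0 < u j * u (Suc j)"
        using neg by (auto simp: not_le)
      then show ?case by (auto simp: zero_less_mult_iff)
    qed
    from this[of N] show False using anti by (simp add: zero_less_mult_iff)
  qed
  then obtain k where k: "k < N" "u k * u (Suc k) \<le> 0" by blast
  obtain r where r: "0 \<le> r" "r \<le> 1" "u k + r * (u (Suc k) - u k) = 0"
  proof (cases "u k = u (Suc k)")
    case True
    then have "u k = 0" using k(2) by (auto simp: mult_le_0_iff)
    then show ?thesis using that[of 0] by simp
  next
    case False
    show ?thesis
    proof (rule that[of "u k / (u k - u (Suc k))"])
      show "0 \<le> u k / (u k - u (Suc k))" "u k / (u k - u (Suc k)) \<le> 1"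
        using k(2) False by (auto simp: mult_le_0_iff divide_simps)
      show "u k + u k / (u k - u (Suc k)) * (u (Suc k) - u k) = 0"
        using False by (simp add: field_simps)
    qed
  qed
  \<comment> \<open>\<open>a\<close> is a zero of the piecewise linear interpolation; \<open>w\<close> starts at \<open>a\<close> and is wrapped around
    the period, and the jump of \<open>w\<close> at \<open>a\<close> is harmless because the interpolation vanishes there.\<close>
  define a where "a = real k + r"
  define C where "C j = (1 + lam * \<theta> powr (1 - p)) * \<bar>u (Suc j) - u j\<bar> powr p
      - lam * (1 - \<theta>) powr (p - 1) * \<bar>u j\<bar> powr p" for j
  \<comment> \<open>\<open>\<Psi>\<close> carries the weight on grid points after the zero,
    \<open>\<Phi>\<close> on those before it, which are reached only after wrapping around; hence
    the shift by \<open>N\<close>.\<close>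
  define \<Phi> where "\<Phi> j = w (real j - a + N) * \<bar>u j\<bar> powr p" for j
  define \<Psi> where "\<Psi> j = w (real j - a) * \<bar>u j\<bar> powr p" for j
  have step: "w (c + \<tau>) * \<bar>u j + \<tau> * (u (Suc j) - u j)\<bar> powr p
      - w (c + \<sigma>) * \<bar>u j + \<sigma> * (u (Suc j) - u j)\<bar> powr p \<le> (\<tau> - \<sigma>) * C j"
    if "0 \<le> \<sigma>" "\<sigma> \<le> \<tau>" "\<tau> \<le> 1" "0 \<le> c + \<sigma>" "c + \<tau> \<le> real N" for c \<sigma> \<tau> :: real and j
    unfolding C_def by (rule Riccati_step[OF p lam \<theta> that(1-3)]) (use w that in auto)
  have before: "\<Phi> (Suc j) - \<Phi> j \<le> C j" if "j < k" for j
  proof -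
    from that have "real j + 1 \<le> real k" by linarith
    then show ?thesis
      using step[of 0 1 "real j - a + N" j] k(1) r
      by (simp add: \<Phi>_def a_def algebra_simps)
  qed
  have after: "\<Psi> (Suc j) - \<Psi> j \<le> C j" if "k < j" "j < N" for j
  proof -
    from that have "real k + 1 \<le> real j" "real j + 1 \<le> real N" by linarith+
    then show ?thesis
      using step[of 0 1 "real j - a" j] r by (simp add: \<Psi>_def a_def algebra_simps)
  qed
  have kN: "real k + 1 \<le> real N" using k(1) by linarith
  \<comment> \<open>The cell containing the zero is split there: this piece ends at the zero with
    \<open>w\<close> at time \<open>N\<close>, the next one starts at the zero with \<open>w\<close>
    at time 0.\<close>
  have at1: "- \<Phi> k \<le> r * C k"
    using step[of 0 r "real k - a + N" k] r p kN by (simp add: \<Phi>_def a_def)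
  have at2: "\<Psi> (Suc k) \<le> (1 - r) * C k"
    using step[of r 1 "real k - a" k] r p kN by (simp add: \<Psi>_def a_def algebra_simps)
  have "(\<Sum>j<k. \<Phi> (Suc j) - \<Phi> j) \<le> (\<Sum>j<k. C j)"
    by (intro sum_mono before) auto
  then have s1: "\<Phi> k - \<Phi> 0 \<le> (\<Sum>j<k. C j)" by (simp add: sum_lessThan_telescope)
  have "(\<Sum>j = Suc k..<N. \<Psi> (Suc j) - \<Psi> j) \<le> (\<Sum>j = Suc k..<N. C j)"
    by (intro sum_mono after) auto
  then have s2: "\<Psi> N - \<Psi> (Suc k) \<le> (\<Sum>j = Suc k..<N. C j)"
    using k(1) by (simp add: sum_Suc_diff')
  have "(\<Sum>j<N. C j) = (\<Sum>j<k. C j) + C k + (\<Sum>j = Suc k..<N. C j)"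
    using sum.atLeastLessThan_concat[of 0 "Suc k" N C] k(1) by (simp add: atLeast0LessThan)
  \<comment> \<open>This glues the two telescoping sums: both sides use \<open>w\<close> at
    \<open>N - a\<close>, and \<open>|u N| = |u 0|\<close>.\<close>
  moreover have "\<Psi> N = \<Phi> 0" by (simp add: \<Psi>_def \<Phi>_def anti)
  ultimately have "0 \<le> (\<Sum>j<N. C j)"
    using s1 s2 at1 at2 by (simp add: algebra_simps)
  then show ?thesis
    by (simp add: C_def sum_subtractf sum_distrib_left)
qed

section \<open>Lifetime of Riccati solutions as a Beta integral\<close>

text \<open>Substitution \<open>t = s powr q / (1 + s powr q)\<close>. The Beta integrand is
  singular at 0, so the fundamental theorem is used with derivatives in the open interval and mere
  continuity at its ends.\<close>

lemma integral_Riccati_eq_incomplete_Beta: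
  fixes p V :: real
  assumes p: "1 < p" and V: "0 \<le> V"
  defines "q \<equiv> p / (p - 1)"
  shows "integral {0..V} (\<lambda>s. 1 / (1 + \<bar>s\<bar> powr q)) = (p - 1) / p *
    integral {0..V powr q / (1 + V powr q)} (\<lambda>t. t powr (- 1 / p) * (1 - t) powr (1 / p - 1))"
proof -
  define k where "k t = t powr (- 1 / p) * (1 - t) powr (1 / p - 1)" for t :: real
  define I where "I x = integral {0..x} k" for x
  define \<tau> where "\<tau> v = v powr q / (1 + v powr q)" for v :: real
  have q: "0 < q" "q - 1 = q / p" "(p - 1) / p * q = 1"
    using p by (auto simp: q_def field_simps)
  have kint: "k integrable_on {0..1}"
    using integrable_Beta'[of "1 - 1 / p" "1 / p"] p by (simp add: k_def [abs_def])
  have Icont: "continuous_on {0..1} I"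
    unfolding I_def [abs_def] by (rule indefinite_integral_continuous_1[OF kint])
  have den: "1 + v powr q > 0" for v :: real
    by (simp add: add_pos_nonneg)
  then have den0: "1 + v powr q \<noteq> 0" for v :: real
    by (metis less_irrefl)
  have \<tau>01: "\<tau> v \<in> {0..1}" for v
    using den[of v] by (auto simp: \<tau>_def)
  have \<tau>cont: "continuous_on {0..V} \<tau>"
    unfolding \<tau>_def [abs_def] using q den0
    by (intro continuous_intros continuous_on_powr') auto
  have cont: "continuous_on {0..V} (\<lambda>v. (p - 1) / p * I (\<tau> v))"
    by (intro continuous_intros continuous_on_compose2[OF Icont \<tau>cont]) (use \<tau>01 in auto)
  have der: "((\<lambda>v. (p - 1) / p * I (\<tau> v)) has_vector_derivative 1 / (1 + \<bar>v\<bar> powr q)) (at v)"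
    if v: "v \<in> {0<..<V}" for v
  proof -
    have v0: "0 < v" using v by simp
    define E where "E = 1 + v powr q"
    have E: "0 < E" using den E_def by simp
    have \<tau>v: "\<tau> v = v powr q / E" "1 - \<tau> v = 1 / E"
      using E by (auto simp: \<tau>_def E_def field_simps)
    have \<tau>in: "0 < \<tau> v" "\<tau> v < 1"
      using \<tau>v E v0 by (auto simp: E_def)
    have d\<tau>: "(\<tau> has_real_derivative q * v powr (q - 1) / (E * E)) (at v)"
      unfolding \<tau>_def [abs_def]
      using v0 E by (auto intro!: derivative_eq_intros simp: E_def powr_diff divide_simps)
        (simp add: algebra_simps)
    have kc: "isCont k (\<tau> v)"
      unfolding k_def [abs_def] using \<tau>in by (intro continuous_intros) auto
    have "(I has_vector_derivative k (\<tau> v)) (at (\<tau> v) within {0..1} - {})"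
      unfolding I_def [abs_def]
      by (rule integral_has_vector_derivative_continuous_at[OF kint])
         (use \<tau>in kc in \<open>auto intro: continuous_at_imp_continuous_at_within\<close>)
    then have "(I has_real_derivative k (\<tau> v)) (at (\<tau> v))"
      using \<tau>in by (simp add: has_real_derivative_iff_has_vector_derivative at_within_Icc_at)
    from DERIV_chain2[OF this d\<tau>]
    have "((\<lambda>v. (p - 1) / p * I (\<tau> v)) has_real_derivative
        (p - 1) / p * (k (\<tau> v) * (q * v powr (q - 1) / (E * E)))) (at v)"
      by (rule DERIV_cmult)
    moreover have "(p - 1) / p * (k (\<tau> v) * (q * v powr (q - 1) / (E * E))) = 1 / E"
    proof -
      have "k (\<tau> v) = \<tau> v powr (- 1 / p) * (1 / E) powr (1 / p - 1)"
        by (simp only: k_def \<tau>v(2))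
      also have "\<dots> = v powr (- (q / p)) * E"
        unfolding \<tau>v(1) using v0 E
        by (simp add: powr_divide powr_powr powr_minus powr_diff field_simps)
      \<comment> \<open>The powers of \<open>v\<close> cancel because
        \<open>q - 1 = q / p\<close>.\<close>
      finally have "k (\<tau> v) * v powr (q - 1) = E"
        using v0 by (simp add: q powr_minus)
      then have "k (\<tau> v) * (q * v powr (q - 1) / (E * E)) = q * E / (E * E)"
        by (simp add: mult_ac)
      also have "\<dots> = q / E" using E by simp
      finally show ?thesis using q(3) by simp
    qed
    ultimately show ?thesis
      using v0 by (simp add: has_real_derivative_iff_has_vector_derivative E_def)
  qed
  have "integral {0..V} (\<lambda>s. 1 / (1 + \<bar>s\<bar> powr q)) = (p - 1) / p * I (\<tau> V) - (p - 1) / p * I (\<tau> 0)"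
    by (intro integral_unique fundamental_theorem_of_calculus_interior V cont der)
  also have "I (\<tau> 0) = 0" using q by (simp add: \<tau>_def I_def)
  finally show ?thesis unfolding I_def \<tau>_def k_def [abs_def] by simp
qed

text \<open>The upper limit of the incomplete Beta integral tends to 1, and the indefinite integral
  is continuous up to 1. The limit is half the maximal lifetime of
  \<open>g' = 1 + |g| powr q\<close>.\<close>

lemma integral_Riccati_tendsto:
  fixes p :: real
  assumes p: "1 < p"
  shows "((\<lambda>V. integral {0..V} (\<lambda>s. 1 / (1 + \<bar>s\<bar> powr (p / (p - 1))))) \<longlongrightarrow> (p - 1) / p *
    integral {0..1} (\<lambda>t. t powr (- 1 / p) * (1 - t) powr (1 / p - 1))) at_top"
proof -
  define q where "q = p / (p - 1)"
  define k where "k t = t powr (- 1 / p) * (1 - t) powr (1 / p - 1)" for t :: real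
  have q: "0 < q" using p by (auto simp: q_def)
  have kint: "k integrable_on {0..1}"
    using integrable_Beta'[of "1 - 1 / p" "1 / p"] p by (simp add: k_def [abs_def])
  have cont: "continuous_on {0..1} (\<lambda>x. integral {0..x} k)"
    by (rule indefinite_integral_continuous_1[OF kint])
  have den: "1 + V powr q > 0" for V :: real
    by (simp add: add_pos_nonneg)
  then have den0: "1 + V powr q \<noteq> 0" for V :: real
    by (metis less_irrefl)
  have "((\<lambda>V. 1 / (1 + V powr (- q))) \<longlongrightarrow> 1 / (1 + 0)) at_top"
    using q by (intro tendsto_intros tendsto_neg_powr filterlim_ident) auto
  moreover have "\<forall>\<^sub>F V in at_top. 1 / (1 + V powr (- q)) = V powr q / (1 + V powr q)"
    using eventually_gt_at_top[of 0]
    by eventually_elim (use den0 in \<open>simp add: powr_minus divide_simps add.commute\<close>)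
  ultimately have lim: "((\<lambda>V. V powr q / (1 + V powr q)) \<longlongrightarrow> 1) at_top"
    by (simp add: filterlim_cong)
  have "((\<lambda>V. integral {0..V powr q / (1 + V powr q)} k) \<longlongrightarrow> integral {0..1} k) at_top"
    by (rule continuous_on_tendsto_compose[OF cont lim]) (use den in auto)
  then have "((\<lambda>V. (p - 1) / p * integral {0..V powr q / (1 + V powr q)} k)
      \<longlongrightarrow> (p - 1) / p * integral {0..1} k) at_top"
    by (intro tendsto_intros)
  moreover have "\<forall>\<^sub>F V in at_top. integral {0..V} (\<lambda>s. 1 / (1 + \<bar>s\<bar> powr q))
      = (p - 1) / p * integral {0..V powr q / (1 + V powr q)} k"
    using eventually_ge_at_top[of 0]
    by eventually_elim
       (use integral_Riccati_eq_incomplete_Beta[OF p] in \<open>simp add: k_def [abs_def] q_def\<close>)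
  ultimately show ?thesis
    unfolding k_def [abs_def] q_def by (simp add: filterlim_cong)
qed

text \<open>Separation of variables: \<open>g\<close> is the inverse of the integral
  \<open>F\<close> of \<open>1 / (1 + |s| powr q)\<close> from \<open>-V\<close>, with
  \<open>V\<close> so large that \<open>F V > c\<close>.\<close>

lemma Riccati_solution_exists:
  fixes p c :: real
  assumes p: "1 < p" and c: "0 \<le> c"
    "c < 2 * ((p - 1) / p * integral {0..1} (\<lambda>t. t powr (- 1 / p) * (1 - t) powr (1 / p - 1)))"
  obtains g :: "real \<Rightarrow> real" where
    "\<And>t. 0 \<le> t \<Longrightarrow> t \<le> c \<Longrightarrow> (g has_real_derivative 1 + \<bar>g t\<bar> powr (p / (p - 1))) (at t)"
proof -
  define q where "q = p / (p - 1)"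
  define \<phi> where "\<phi> s = 1 / (1 + \<bar>s\<bar> powr q)" for s :: real
  have q: "0 < q" using p by (auto simp: q_def)
  have "\<forall>\<^sub>F V in at_top. c / 2 < integral {0..V} \<phi>"
    unfolding \<phi>_def [abs_def] q_def
    by (rule order_tendstoD(1)[OF integral_Riccati_tendsto[OF p]]) (use c in linarith)
  with eventually_ge_at_top[of 0] have "\<forall>\<^sub>F V in at_top. 0 \<le> V \<and> c / 2 < integral {0..V} \<phi>"
    by (rule eventually_conj)
  then obtain V where V: "0 \<le> V" "c / 2 < integral {0..V} \<phi>"
    by (auto dest!: eventually_happens)
  define F where "F v = integral {-V..v} \<phi>" for v
  have den: "1 + \<bar>v\<bar> powr q > 0" for v :: real
    by (simp add: add_pos_nonneg)
  then have den0: "1 + \<bar>v\<bar> powr q \<noteq> 0" for v :: real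
    by (metis less_irrefl)
  have cont: "continuous_on {-V..V} \<phi>"
    unfolding \<phi>_def [abs_def] using q den0
    by (intro continuous_intros continuous_on_powr') auto
  have "integral {-V..0} \<phi> = integral {0..V} \<phi>"
    using Henstock_Kurzweil_Integration.integral_reflect_real[where f = \<phi> and a = 0 and b = V] by (simp add: \<phi>_def [abs_def])
  then have FV: "c < F V"
    using Henstock_Kurzweil_Integration.integral_combine[of "-V" 0 V \<phi>] V integrable_continuous_real[OF cont]
    by (simp add: F_def)
  have F0: "F (-V) = 0" by (simp add: F_def)
  have Fder': "(F has_real_derivative \<phi> v) (at v within {-V..V})" if "v \<in> {-V..V}" for v
    unfolding F_def [abs_def] by (rule integral_has_real_derivative[OF cont that])
  then have Fcont: "continuous_on {-V..V} F"
    by (rule DERIV_continuous_on)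
  have Fder: "(F has_real_derivative \<phi> v) (at v)" if "-V < v" "v < V" for v
    using Fder'[of v] that by (simp add: at_within_Icc_at)
  have mono: "F v < F v'" if "-V < v" "v < v'" "v' < V" for v v'
  proof (rule DERIV_pos_imp_increasing[OF that(2)])
    fix s assume "v \<le> s" "s \<le> v'"
    then show "\<exists>y. (F has_real_derivative y) (at s) \<and> 0 < y"
      using Fder[of s] that den[of s] by (auto simp: \<phi>_def)
  qed
  define S where "S = {-V<..<V}"
  have inj: "inj_on F S"
    by (rule linorder_inj_onI) (use mono in \<open>force simp: S_def\<close>)+
  \<comment> \<open>The shift centres \<open>[0, c]\<close> in the open range
    \<open>(0, F V)\<close>, so that two-sided derivatives exist at both ends.\<close>
  define \<delta> where "\<delta> = (F V - c) / 2"
  define G where "G = inv_into S F"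
  have GS: "G (t + \<delta>) \<in> S" "F (G (t + \<delta>)) = t + \<delta>" if "0 \<le> t" "t \<le> c" for t
  proof -
    have t: "0 < t + \<delta>" "t + \<delta> < F V" using that FV by (auto simp: \<delta>_def field_simps)
    obtain v where v: "-V \<le> v" "v \<le> V" "F v = t + \<delta>"
      using IVT'[of F "-V" "t + \<delta>" V] t F0 V Fcont by auto
    then have "v \<in> S" using t F0 by (force simp: S_def less_le)
    then have "t + \<delta> \<in> F ` S" using v by (metis imageI)
    then show "G (t + \<delta>) \<in> S" "F (G (t + \<delta>)) = t + \<delta>"
      unfolding G_def by (auto simp: inv_into_into f_inv_into_f)
  qed
  show ?thesis
  proof (rule that[of "\<lambda>t. G (t + \<delta>)"])
    fix t assume t: "0 \<le> t" "t \<le> c"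
    let ?v = "G (t + \<delta>)"
    have v: "?v \<in> S" "F ?v = t + \<delta>" using GS[OF t] by auto
    have \<phi>v: "\<phi> ?v \<noteq> 0" using den[of ?v] by (simp add: \<phi>_def)
    have "(G has_derivative (*) (1 / \<phi> ?v)) (at (F ?v))"
    proof (rule has_derivative_inverse_strong[where S = S and f = F and f' = "\<lambda>h. \<phi> ?v * h"])
      show "continuous_on S F"
        using Fcont by (rule continuous_on_subset) (auto simp: S_def)
      show "(F has_derivative (\<lambda>h. \<phi> ?v * h)) (at ?v)"
        using Fder[of ?v] v by (auto simp: S_def has_field_derivative_def)
      show "G (F z) = z" if "z \<in> S" for z
        using inj that by (simp add: G_def)
    qed (use v \<phi>v in \<open>auto simp: S_def fun_eq_iff\<close>)
    then have "(G has_real_derivative 1 / \<phi> ?v) (at (t + \<delta>))"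
      using v by (simp add: has_field_derivative_def)
    then show "((\<lambda>t. G (t + \<delta>)) has_real_derivative 1 + \<bar>?v\<bar> powr (p / (p - 1))) (at t)"
      using DERIV_shift[of G _ t \<delta>] by (simp add: \<phi>_def q_def)
  qed
qed

section \<open>The constant \<open>Cp\<close> and the Wirtinger inequality for sequences\<close>

lemma Cp_pos: "0 < Cp p" if "1 < p"
proof -
  have "((\<lambda>t. t powr (- 1 / p) * (1 - t) powr (1 / p - 1)) has_integral Beta (1 - 1 / p) (1 / p)) {0..1}"
    using has_integral_Beta_real[of "1 - 1 / p" "1 / p"] that by simp
  then have "integral {0..1} (\<lambda>t. t powr (- 1 / p) * (1 - t) powr (1 / p - 1)) = Beta (1 - 1 / p) (1 / p)"
    by (rule integral_unique)
  also have "\<dots> > 0"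
    using that by (auto simp: Beta_def intro!: Gamma_real_pos divide_pos_pos mult_pos_pos)
  finally show ?thesis
    using that by (simp add: Cp_def)
qed

text \<open>For \<open>N \<longrightarrow> \<infinity>\<close> and \<open>\<theta> \<longrightarrow> 0\<close> this becomes the sharp Wirtinger inequality for
  antiperiodic functions; stating it for sequences lets it be integrated over the measure space
  without joint measurability in time and space.\<close>

lemma discrete_Wirtinger:
  fixes p \<rho> \<theta> :: real and u :: "nat \<Rightarrow> real"
  assumes p: "1 < p" and \<rho>: "0 < \<rho>" "\<rho> < 1 / (2 * Cp p)" and \<theta>: "0 < \<theta>" "\<theta> < 1"
    and N: "0 < N" and anti: "u N = - u 0"
  shows "(\<rho> / N) powr p * (1 - \<theta>) powr (p - 1) * (\<Sum>j<N. \<bar>u j\<bar> powr p)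
    \<le> (1 + (\<rho> / N) powr p * \<theta> powr (1 - p)) * (\<Sum>j<N. \<bar>u (Suc j) - u j\<bar> powr p)"
proof -
  define B where "B = integral {0..1} (\<lambda>t. t powr (- 1 / p) * (1 - t) powr (1 / p - 1))"
  define q where "q = p / (p - 1)"
  \<comment> \<open>With this scaling, \<open>\<rho> < 1 / (2 * Cp p)\<close> says that
    \<open>c\<close> is below the maximal lifetime. The factor \<open>\<kappa>\<close> maps
    \<open>[0, N]\<close> onto \<open>[0, c]\<close>, and \<open>\<mu>\<close> solves
    \<open>(p - 1) * \<mu> powr q = \<mu> * \<kappa>\<close>, so that
    \<open>- \<mu> * g (\<kappa> * s)\<close> satisfies the required equation with parameter
    \<open>\<mu> * \<kappa> = (\<rho> / N) powr p\<close>.\<close>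
  define c where "c = \<rho> * (p - 1) powr (1 - 1 / p)"
  define \<kappa> where "\<kappa> = c / N"
  define \<mu> where "\<mu> = (\<kappa> / (p - 1)) powr (p - 1)"
  have pos: "0 < c" "0 < \<kappa>" "0 < \<mu>"
    using p \<rho> N by (auto simp: c_def \<kappa>_def \<mu>_def)
  have "1 / (2 * Cp p) = 2 * (p - 1) powr (1 / p) * B / p"
    using p by (simp add: Cp_def B_def)
  then have "c < 2 * (p - 1) powr (1 / p) * B / p * (p - 1) powr (1 - 1 / p)"
    unfolding c_def using p \<rho>(2) by (intro mult_strict_right_mono) auto
  also have "\<dots> = 2 * B / p * ((p - 1) powr (1 / p) * (p - 1) powr (1 - 1 / p))"
    by simp
  also have "\<dots> = 2 * ((p - 1) / p * B)"
    using p by (simp flip: powr_add)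
  finally obtain g :: "real \<Rightarrow> real" where g:
    "\<And>t. 0 \<le> t \<Longrightarrow> t \<le> c \<Longrightarrow> (g has_real_derivative 1 + \<bar>g t\<bar> powr q) (at t)"
    using Riccati_solution_exists[OF p, of c] pos unfolding B_def q_def by (metis less_imp_le)
  have lam: "\<mu> * \<kappa> = (\<rho> / N) powr p"
  proof -
    have "\<mu> * \<kappa> = \<kappa> powr p / (p - 1) powr (p - 1)"
      using p pos by (simp add: \<mu>_def powr_divide powr_diff)
    also have "\<kappa> powr p = (\<rho> / N) powr p * (p - 1) powr (p - 1)"
      using p \<rho> N by (simp add: \<kappa>_def c_def powr_mult powr_divide powr_powr left_diff_distrib)
    finally show ?thesis using p by simp
  qed
  have \<mu>q: "(p - 1) * \<mu> powr q = \<mu> * \<kappa>"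
  proof -
    have "\<mu> powr q = (\<kappa> / (p - 1)) powr p"
      using p by (simp add: \<mu>_def q_def powr_powr)
    also have "\<dots> = \<mu> * (\<kappa> / (p - 1))"
      using p pos by (simp add: \<mu>_def powr_diff)
    finally show ?thesis using p by simp
  qed
  define w where "w s = - \<mu> * g (\<kappa> * s)" for s
  show ?thesis
  proof (rule Riccati_discrete_inequality[OF p _ \<theta> _ N anti])
    fix s assume s: "0 \<le> s" "s \<le> real N"
    have "\<kappa> * s \<le> c"
      using s N pos by (simp add: \<kappa>_def field_simps)
    then have "(g has_real_derivative 1 + \<bar>g (\<kappa> * s)\<bar> powr q) (at (\<kappa> * s))"
      using g[of "\<kappa> * s"] s pos by simp
    then have "((\<lambda>s. g (\<kappa> * s)) has_real_derivative (1 + \<bar>g (\<kappa> * s)\<bar> powr q) * \<kappa>) (at s)"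
      by (rule DERIV_chain2) (auto intro!: derivative_eq_intros)
    then have "(w has_real_derivative - \<mu> * ((1 + \<bar>g (\<kappa> * s)\<bar> powr q) * \<kappa>)) (at s)"
      unfolding w_def [abs_def] by (rule DERIV_cmult)
    moreover have "- \<mu> * ((1 + \<bar>g (\<kappa> * s)\<bar> powr q) * \<kappa>)
        = - (\<mu> * \<kappa> + (\<mu> * \<kappa>) * \<bar>g (\<kappa> * s)\<bar> powr q)"
      by (simp add: algebra_simps)
    moreover have "(\<mu> * \<kappa>) * \<bar>g (\<kappa> * s)\<bar> powr q = (p - 1) * \<bar>w s\<bar> powr q"
      unfolding \<mu>q [symmetric] using pos by (simp add: w_def abs_mult powr_mult)
    ultimately show "(w has_real_derivative
        - ((\<rho> / N) powr p + (p - 1) * \<bar>w s\<bar> powr (p / (p - 1)))) (at s)"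
      by (simp add: lam q_def)
  qed simp
qed

section \<open>The seminorm of L^p and curves in L^p\<close>

lemma Lp_setD:
  assumes "g \<in> Lp_set p M"
  shows "g \<in> borel_measurable M" "(\<integral>\<^sup>+ w. ennreal (\<bar>g w\<bar> powr p) \<partial>M) < \<infinity>"
  using assms by (auto simp: Lp_set_def)

lemma Lp_norm_nonneg [simp]: "0 \<le> Lp_norm p M g"
  by (simp add: Lp_norm_def)

lemma nn_integral_powr_eq_Lp_norm:
  assumes "0 < p" "g \<in> Lp_set p M"
  shows "(\<integral>\<^sup>+ w. ennreal (\<bar>g w\<bar> powr p) \<partial>M) = ennreal (Lp_norm p M g powr p)"
  using assms by (simp add: Lp_set_def Lp_norm_def powr_powr less_top)

lemma Lp_norm_le:
  assumes "0 < p" "0 \<le> a" "(\<integral>\<^sup>+ w. ennreal (\<bar>g w\<bar> powr p) \<partial>M) \<le> ennreal (a powr p)"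
  shows "Lp_norm p M g \<le> a"
proof -
  have "enn2real (\<integral>\<^sup>+ w. ennreal (\<bar>g w\<bar> powr p) \<partial>M) \<le> enn2real (ennreal (a powr p))"
    by (rule enn2real_mono) (use assms in auto)
  then have "Lp_norm p M g \<le> (a powr p) powr (1 / p)"
    unfolding Lp_norm_def using assms by (intro powr_mono2) auto
  then show ?thesis using assms by (simp add: powr_powr)
qed

lemma Lp_norm_minus_commute: "Lp_norm p M (\<lambda>w. f w - g w) = Lp_norm p M (\<lambda>w. g w - f w)"
  by (simp add: Lp_norm_def abs_minus_commute)

lemma Lp_cmult:
  assumes "0 < p" "g \<in> Lp_set p M"
  shows "(\<lambda>w. c * g w) \<in> Lp_set p M" "Lp_norm p M (\<lambda>w. c * g w) = \<bar>c\<bar> * Lp_norm p M g"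
proof -
  have [measurable]: "g \<in> borel_measurable M" using assms by (simp add: Lp_setD)
  have *: "(\<integral>\<^sup>+ w. ennreal (\<bar>c * g w\<bar> powr p) \<partial>M)
      = ennreal (\<bar>c\<bar> powr p) * (\<integral>\<^sup>+ w. ennreal (\<bar>g w\<bar> powr p) \<partial>M)"
    by (simp add: abs_mult powr_mult ennreal_mult nn_integral_cmult)
  then show "(\<lambda>w. c * g w) \<in> Lp_set p M"
    using Lp_setD(2)[OF assms(2)] by (simp add: Lp_set_def ennreal_mult_less_top)
  show "Lp_norm p M (\<lambda>w. c * g w) = \<bar>c\<bar> * Lp_norm p M g"
    unfolding Lp_norm_def * using assms(1) by (simp add: enn2real_mult powr_mult powr_powr)
qed

text \<open>Minkowski's inequality by integrating the weighted convexity bound. The strict bounds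
  \<open>a\<close> and \<open>b\<close> keep the weight inside \<open>(0, 1)\<close> even when a
  seminorm is 0, and the extended form gives membership and the triangle inequality at once.\<close>

lemma nn_integral_powr_add_le:
  assumes p: "1 < p" and f: "f \<in> Lp_set p M" and g: "g \<in> Lp_set p M"
    and a: "Lp_norm p M f < a" and b: "Lp_norm p M g < b"
  shows "(\<integral>\<^sup>+ w. ennreal (\<bar>f w + g w\<bar> powr p) \<partial>M) \<le> ennreal ((a + b) powr p)"
proof -
  have [measurable]: "f \<in> borel_measurable M" "g \<in> borel_measurable M"
    using f g by (auto simp: Lp_setD)
  have pos: "0 < a" "0 < b"
    using a b Lp_norm_nonneg le_less_trans by blast+
  \<comment> \<open>With this weight the right-hand side collapses to
    \<open>(a + b) powr p\<close>.\<close>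
  define \<theta> where "\<theta> = b / (a + b)"
  have \<theta>: "0 < \<theta>" "\<theta> < 1" "1 - \<theta> = a / (a + b)"
    using pos by (auto simp: \<theta>_def field_simps)
  have "\<bar>f w + g w\<bar> powr p \<le> (1 - \<theta>) powr (1 - p) * \<bar>f w\<bar> powr p + \<theta> powr (1 - p) * \<bar>g w\<bar> powr p" for w
  proof -
    have "\<bar>f w + g w\<bar> powr p \<le> (\<bar>f w\<bar> + \<bar>g w\<bar>) powr p"
      using p by (intro powr_mono2) auto
    also have "\<dots> \<le> (1 - \<theta>) powr (1 - p) * \<bar>f w\<bar> powr p + \<theta> powr (1 - p) * \<bar>g w\<bar> powr p"
      by (rule powr_add_le_weighted) (use p \<theta> in auto)
    finally show ?thesis .
  qed
  then have "(\<integral>\<^sup>+ w. ennreal (\<bar>f w + g w\<bar> powr p) \<partial>M)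
      \<le> (\<integral>\<^sup>+ w. ennreal ((1 - \<theta>) powr (1 - p)) * ennreal (\<bar>f w\<bar> powr p)
          + ennreal (\<theta> powr (1 - p)) * ennreal (\<bar>g w\<bar> powr p) \<partial>M)"
    by (intro nn_integral_mono) (simp add: ennreal_leI flip: ennreal_plus ennreal_mult)
  also have "\<dots> = ennreal ((1 - \<theta>) powr (1 - p)) * ennreal (Lp_norm p M f powr p)
      + ennreal (\<theta> powr (1 - p)) * ennreal (Lp_norm p M g powr p)"
    using p f g by (simp add: nn_integral_add nn_integral_cmult nn_integral_powr_eq_Lp_norm)
  also have "\<dots> = ennreal ((1 - \<theta>) powr (1 - p) * Lp_norm p M f powr p
      + \<theta> powr (1 - p) * Lp_norm p M g powr p)"
    by (simp flip: ennreal_plus ennreal_mult)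
  also have "\<dots> \<le> ennreal ((1 - \<theta>) powr (1 - p) * a powr p + \<theta> powr (1 - p) * b powr p)"
    using p a b by (intro ennreal_leI add_mono mult_left_mono powr_mono2) auto
  also have "(1 - \<theta>) powr (1 - p) * a powr p + \<theta> powr (1 - p) * b powr p = (a + b) powr p"
  proof -
    have "(c / (a + b)) powr (1 - p) * c powr p = c * (a + b) powr (p - 1)" if "0 < c" for c
      using that pos by (simp add: powr_divide powr_diff)
    then have "(1 - \<theta>) powr (1 - p) * a powr p + \<theta> powr (1 - p) * b powr p
        = (a + b) * (a + b) powr (p - 1)"
      using pos unfolding \<theta>(3) unfolding \<theta>_def by (simp add: algebra_simps)
    then show ?thesis using pos by (simp add: powr_diff)
  qed
  finally show ?thesis .
qed

lemma Lp_add: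
  assumes p: "1 < p" and f: "f \<in> Lp_set p M" and g: "g \<in> Lp_set p M"
  shows "(\<lambda>w. f w + g w) \<in> Lp_set p M"
    and Lp_norm_triangle: "Lp_norm p M (\<lambda>w. f w + g w) \<le> Lp_norm p M f + Lp_norm p M g"
proof -
  have "(\<integral>\<^sup>+ w. ennreal (\<bar>f w + g w\<bar> powr p) \<partial>M)
      \<le> ennreal ((Lp_norm p M f + 1 + (Lp_norm p M g + 1)) powr p)"
    by (rule nn_integral_powr_add_le[OF p f g]) auto
  then show "(\<lambda>w. f w + g w) \<in> Lp_set p M"
    using f g by (auto simp: Lp_set_def intro: le_less_trans)
  show "Lp_norm p M (\<lambda>w. f w + g w) \<le> Lp_norm p M f + Lp_norm p M g"
  proof (rule field_le_epsilon)
    fix e :: real assume "0 < e"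
    then have "Lp_norm p M (\<lambda>w. f w + g w) \<le> (Lp_norm p M f + e / 2) + (Lp_norm p M g + e / 2)"
      using p by (intro Lp_norm_le nn_integral_powr_add_le[OF p f g]) auto
    then show "Lp_norm p M (\<lambda>w. f w + g w) \<le> Lp_norm p M f + Lp_norm p M g + e" by simp
  qed
qed

lemma Lp_diff:
  assumes p: "1 < p" and f: "f \<in> Lp_set p M" and g: "g \<in> Lp_set p M"
  shows "(\<lambda>w. f w - g w) \<in> Lp_set p M"
    and Lp_norm_triangle_diff: "Lp_norm p M (\<lambda>w. f w - g w) \<le> Lp_norm p M f + Lp_norm p M g"
  using Lp_add[OF p f Lp_cmult(1)[of p g M "-1"]] Lp_norm_triangle[OF p f Lp_cmult(1)[of p g M "-1"]]
    Lp_cmult(2)[of p g M "-1"] p g by auto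

lemma Lp_dist_triangle:
  assumes "1 < p" "f \<in> Lp_set p M" "g \<in> Lp_set p M" "h \<in> Lp_set p M"
  shows "Lp_norm p M (\<lambda>w. f w - h w) \<le> Lp_norm p M (\<lambda>w. f w - g w) + Lp_norm p M (\<lambda>w. g w - h w)"
  using Lp_norm_triangle[OF assms(1) Lp_diff(1)[OF assms(1,2,3)] Lp_diff(1)[OF assms(1,3,4)]] by simp

lemma Lp_norm_le_add_dist:
  assumes "1 < p" "f \<in> Lp_set p M" "g \<in> Lp_set p M"
  shows "Lp_norm p M f \<le> Lp_norm p M g + Lp_norm p M (\<lambda>w. f w - g w)"
  using Lp_norm_triangle[OF assms(1,3) Lp_diff(1)[OF assms]] by simp

lemma Lp_norm_eq_0D:
  assumes "0 < p" "g \<in> Lp_set p M" "Lp_norm p M g = 0"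
  shows "AE w in M. g w = 0"
proof -
  have [measurable]: "g \<in> borel_measurable M" using assms by (simp add: Lp_setD)
  have "(\<integral>\<^sup>+ w. ennreal (\<bar>g w\<bar> powr p) \<partial>M) = 0"
    using nn_integral_powr_eq_Lp_norm[OF assms(1,2)] assms(3) by simp
  then show ?thesis
    by (subst (asm) nn_integral_0_iff_AE) (auto elim!: eventually_mono simp: ennreal_eq_0_iff)
qed

section \<open>Differentiable curves: mean value and growth estimates\<close>

text \<open>The increment is \<open>h * r + h * v\<close> with a remainder \<open>r\<close> of
  seminorm below \<open>e\<close> for small \<open>h\<close>.\<close>

lemma Lp_has_derivative_local_bound:
  assumes p: "1 < p" and y: "\<And>t. y t \<in> Lp_set p M" and v: "v \<in> Lp_set p M"
    and der: "Lp_has_derivative p M y v t" and e: "0 < e"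
  obtains d where "0 < d" "\<And>s. \<bar>s - t\<bar> < d \<Longrightarrow>
    Lp_norm p M (\<lambda>w. y s w - y t w) \<le> \<bar>s - t\<bar> * (Lp_norm p M v + e)"
proof -
  have "\<forall>\<^sub>F h in at 0. Lp_norm p M (\<lambda>w. (y (t + h) w - y t w) / h - v w) < e"
    using order_tendstoD(2)[OF der[unfolded Lp_has_derivative_def] e] .
  then obtain d where d: "0 < d" "\<And>h. h \<noteq> 0 \<Longrightarrow> \<bar>h\<bar> < d \<Longrightarrow>
      Lp_norm p M (\<lambda>w. (y (t + h) w - y t w) / h - v w) < e"
    unfolding eventually_at by (auto simp: dist_real_def)
  have "Lp_norm p M (\<lambda>w. y s w - y t w) \<le> \<bar>s - t\<bar> * (Lp_norm p M v + e)" if "\<bar>s - t\<bar> < d" for s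
  proof (cases "s = t")
    case True
    then show ?thesis using p by (simp add: Lp_norm_def)
  next
    case False
    define h where "h = s - t"
    define r where "r w = (y (t + h) w - y t w) / h - v w" for w
    have h: "h \<noteq> 0" "\<bar>h\<bar> < d" using False that by (auto simp: h_def)
    have "(\<lambda>w. (1 / h) * (y (t + h) w - y t w)) \<in> Lp_set p M"
      using p y by (intro Lp_cmult Lp_diff) auto
    then have r: "r \<in> Lp_set p M"
      using Lp_diff(1)[OF p _ v] by (simp add: r_def [abs_def])
    have eq: "(\<lambda>w. y s w - y t w) = (\<lambda>w. h * r w + h * v w)"
      using h by (auto simp: r_def h_def field_simps)
    have "Lp_norm p M (\<lambda>w. y s w - y t w) \<le> \<bar>h\<bar> * Lp_norm p M r + \<bar>h\<bar> * Lp_norm p M v"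
      unfolding eq using Lp_norm_triangle[OF p Lp_cmult(1)[OF _ r, of h] Lp_cmult(1)[OF _ v, of h]] p
      by (simp add: Lp_cmult(2) r v)
    also have "\<dots> \<le> \<bar>h\<bar> * e + \<bar>h\<bar> * Lp_norm p M v"
      using d(2)[OF h] by (intro add_right_mono mult_left_mono) (simp_all add: r_def [abs_def])
    finally show ?thesis
      by (simp add: h_def algebra_simps)
  qed
  with d(1) that show ?thesis by blast
qed

text \<open>With slack \<open>e\<close> the bound holds on all short intervals around each point and
  is additive under concatenation, so compactness extends it to \<open>[a, b]\<close>; then
  \<open>e\<close> tends to 0.\<close>

lemma Lp_mean_value_inequality:
  assumes p: "1 < p" and y: "\<And>t. y t \<in> Lp_set p M" and v: "\<And>t. v t \<in> Lp_set p M"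
    and der: "\<And>t. Lp_has_derivative p M y (v t) t" and ab: "a \<le> b"
    and B: "\<And>t. a \<le> t \<Longrightarrow> t \<le> b \<Longrightarrow> Lp_norm p M (v t) \<le> B"
  shows "Lp_norm p M (\<lambda>w. y b w - y a w) \<le> (b - a) * B"
proof -
  have approx: "Lp_norm p M (\<lambda>w. y b w - y a w) \<le> (b - a) * (B + e)" if e: "0 < e" for e
    using ab
  proof (induction rule: Bolzano)
    case (trans a b c)
    then show ?case
      using Lp_dist_triangle[OF p y[of c] y[of b] y[of a]] by (simp add: algebra_simps)
  next
    case (local t)
    obtain d where d: "0 < d" "\<And>s. \<bar>s - t\<bar> < d \<Longrightarrow>
        Lp_norm p M (\<lambda>w. y s w - y t w) \<le> \<bar>s - t\<bar> * (Lp_norm p M (v t) + e)"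
      using Lp_has_derivative_local_bound[OF p y v der e] by blast
    have bound: "Lp_norm p M (\<lambda>w. y s w - y t w) \<le> \<bar>s - t\<bar> * (B + e)" if "\<bar>s - t\<bar> < d" for s
      using d(2)[OF that] mult_left_mono[OF add_right_mono[OF B[OF local]], of "\<bar>s - t\<bar>" e] by simp
    \<comment> \<open>The local bound compares only with time \<open>t\<close>, so the interval is
      split at \<open>t\<close>.\<close>
    have "Lp_norm p M (\<lambda>w. y b' w - y a' w) \<le> (b' - a') * (B + e)"
      if "a' \<le> t" "t \<le> b'" "b' - a' < d" for a' b'
    proof -
      have "Lp_norm p M (\<lambda>w. y b' w - y a' w)
          \<le> Lp_norm p M (\<lambda>w. y b' w - y t w) + Lp_norm p M (\<lambda>w. y t w - y a' w)"
        by (rule Lp_dist_triangle[OF p y y y])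
      also have "\<dots> \<le> (b' - t) * (B + e) + (t - a') * (B + e)"
        using bound[of b'] bound[of a'] that by (simp add: Lp_norm_minus_commute[of p M "y t"])
      finally show ?thesis by (simp add: algebra_simps)
    qed
    then show ?case using d(1) by blast
  qed
  show ?thesis
  proof (cases "a = b")
    case True
    then show ?thesis using p by (simp add: Lp_norm_def)
  next
    case False
    show ?thesis
    proof (rule field_le_epsilon)
      fix e :: real assume "0 < e"
      with False ab approx[of "e / (b - a)"]
      show "Lp_norm p M (\<lambda>w. y b w - y a w) \<le> (b - a) * B + e" by (simp add: distrib_left)
    qed
  qed
qed

lemma Lp_norm_continuous:
  assumes p: "1 < p" and y: "\<And>t. y t \<in> Lp_set p M" and v: "\<And>t. v t \<in> Lp_set p M"
    and der: "\<And>t. Lp_has_derivative p M y (v t) t"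
  shows "isCont (\<lambda>t. Lp_norm p M (y t)) t"
proof -
  obtain d where d: "0 < d" "\<And>s. \<bar>s - t\<bar> < d \<Longrightarrow>
      Lp_norm p M (\<lambda>w. y s w - y t w) \<le> \<bar>s - t\<bar> * (Lp_norm p M (v t) + 1)"
    using Lp_has_derivative_local_bound[OF p y v der zero_less_one] by blast
  have "((\<lambda>s. \<bar>s - t\<bar> * (Lp_norm p M (v t) + 1)) \<longlongrightarrow> \<bar>t - t\<bar> * (Lp_norm p M (v t) + 1)) (at t)"
    by (intro tendsto_intros)
  then have lim: "((\<lambda>s. \<bar>s - t\<bar> * (Lp_norm p M (v t) + 1)) \<longlongrightarrow> 0) (at t)" by simp
  have "((\<lambda>s. Lp_norm p M (y s) - Lp_norm p M (y t)) \<longlongrightarrow> 0) (at t)"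
  proof (rule Lim_null_comparison[OF _ lim])
    have "\<bar>Lp_norm p M (y s) - Lp_norm p M (y t)\<bar> \<le> \<bar>s - t\<bar> * (Lp_norm p M (v t) + 1)"
      if "\<bar>s - t\<bar> < d" for s
      using d(2)[OF that] Lp_norm_le_add_dist[OF p y y, of s t] Lp_norm_le_add_dist[OF p y y, of t s]
      by (simp add: Lp_norm_minus_commute[of p M "y t"])
    then show "\<forall>\<^sub>F s in at t. norm (Lp_norm p M (y s) - Lp_norm p M (y t))
        \<le> \<bar>s - t\<bar> * (Lp_norm p M (v t) + 1)"
      unfolding eventually_at using d(1) by (auto simp: dist_real_def)
  qed
  then show ?thesis by (simp add: isCont_def LIM_zero_iff)
qed

text \<open>For the maximum \<open>m\<close> of the seminorm on \<open>[a, a + h]\<close>, the mean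
  value inequality gives \<open>m \<le> Lp_norm p M (y a) + h * L * m\<close>; solving for
  \<open>m\<close> and applying it again bounds the increment by the left endpoint alone, as needed
  to compare the two sums over the grid.\<close>

lemma Lp_increment_le:
  assumes p: "1 < p" and y: "\<And>t. y t \<in> Lp_set p M" and v: "\<And>t. v t \<in> Lp_set p M"
    and der: "\<And>t. Lp_has_derivative p M y (v t) t"
    and vy: "\<And>t. Lp_norm p M (v t) \<le> L * Lp_norm p M (y t)"
    and L: "0 \<le> L" and h: "0 \<le> h" "h * L < 1"
  shows "Lp_norm p M (\<lambda>w. y (a + h) w - y a w) \<le> h * L / (1 - h * L) * Lp_norm p M (y a)"
proof -
  have "continuous_on {a..a + h} (\<lambda>t. Lp_norm p M (y t))"
    using Lp_norm_continuous[OF p y v der] by (simp add: continuous_at_imp_continuous_on)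
  then obtain s where s: "s \<in> {a..a + h}" "\<And>t. t \<in> {a..a + h} \<Longrightarrow> Lp_norm p M (y t) \<le> Lp_norm p M (y s)"
    using continuous_attains_sup[of "{a..a + h}" "\<lambda>t. Lp_norm p M (y t)"] h(1) by auto
  define m where "m = Lp_norm p M (y s)"
  have m: "Lp_norm p M (v t) \<le> L * m" if "t \<in> {a..a + h}" for t
    using vy[of t] mult_left_mono[OF s(2)[OF that] L] by (simp add: m_def)
  have m0: "0 \<le> L * m" using L by (simp add: m_def)
  have "m \<le> Lp_norm p M (y a) + Lp_norm p M (\<lambda>w. y s w - y a w)"
    unfolding m_def by (rule Lp_norm_le_add_dist[OF p y y])
  also have "Lp_norm p M (\<lambda>w. y s w - y a w) \<le> (s - a) * (L * m)"
    by (rule Lp_mean_value_inequality[OF p y v der]) (use s m in auto)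
  also have "\<dots> \<le> h * (L * m)"
    using s m0 by (intro mult_right_mono) auto
  finally have "m * (1 - h * L) \<le> Lp_norm p M (y a)" by (simp add: algebra_simps)
  then have m_le: "m \<le> Lp_norm p M (y a) / (1 - h * L)"
    using h by (simp add: pos_le_divide_eq)
  have "Lp_norm p M (\<lambda>w. y (a + h) w - y a w) \<le> (a + h - a) * (L * m)"
    by (rule Lp_mean_value_inequality[OF p y v der]) (use h m in auto)
  also have "\<dots> = h * L * m" by simp
  also have "\<dots> \<le> h * L * (Lp_norm p M (y a) / (1 - h * L))"
    using h L m_le by (intro mult_left_mono) auto
  finally show ?thesis by simp
qed

section \<open>Periodic orbits\<close>

text \<open>The inequality for sequences holds at almost every \<open>w\<close>, namely where
  \<open>Y N w = - Y 0 w\<close>, and both sides are finite sums that can be integrated term by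
  term.\<close>

lemma Lp_sum_discrete_Wirtinger:
  fixes Y :: "nat \<Rightarrow> 'a \<Rightarrow> real"
  assumes p: "1 < p" and \<rho>: "0 < \<rho>" "\<rho> < 1 / (2 * Cp p)" and \<theta>: "0 < \<theta>" "\<theta> < 1"
    and N: "0 < N" and Y: "\<And>j. Y j \<in> Lp_set p M"
    and anti: "Lp_norm p M (\<lambda>w. Y N w + Y 0 w) = 0"
  shows "(\<rho> / N) powr p * (1 - \<theta>) powr (p - 1) * (\<Sum>j<N. Lp_norm p M (Y j) powr p)
    \<le> (1 + (\<rho> / N) powr p * \<theta> powr (1 - p)) *
       (\<Sum>j<N. Lp_norm p M (\<lambda>w. Y (Suc j) w - Y j w) powr p)"
proof -
  define c where "c = (\<rho> / N) powr p * (1 - \<theta>) powr (p - 1)"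
  define C where "C = 1 + (\<rho> / N) powr p * \<theta> powr (1 - p)"
  have cC: "0 \<le> c" "0 \<le> C" by (auto simp: c_def C_def)
  have int: "(\<integral>\<^sup>+ w. ennreal (k * (\<Sum>j<N. \<bar>g j w\<bar> powr p)) \<partial>M)
      = ennreal (k * (\<Sum>j<N. Lp_norm p M (g j) powr p))"
    if g: "\<And>j. g j \<in> Lp_set p M" and k: "0 \<le> k" for g k
  proof -
    have [measurable]: "g j \<in> borel_measurable M" for j by (rule Lp_setD[OF g])
    have "(\<integral>\<^sup>+ w. ennreal (k * (\<Sum>j<N. \<bar>g j w\<bar> powr p)) \<partial>M)
        = (\<integral>\<^sup>+ w. ennreal k * (\<Sum>j<N. ennreal (\<bar>g j w\<bar> powr p)) \<partial>M)"
      using k by (simp add: ennreal_mult sum_nonneg)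
    also have "\<dots> = ennreal k * (\<Sum>j<N. ennreal (Lp_norm p M (g j) powr p))"
      using p g by (simp add: nn_integral_cmult nn_integral_sum nn_integral_powr_eq_Lp_norm del: sum_ennreal)
    finally show ?thesis using k by (simp add: ennreal_mult sum_nonneg)
  qed
  have "AE w in M. Y N w + Y 0 w = 0"
    using p by (intro Lp_norm_eq_0D[OF _ _ anti] Lp_add Y) auto
  then have "AE w in M. c * (\<Sum>j<N. \<bar>Y j w\<bar> powr p) \<le> C * (\<Sum>j<N. \<bar>Y (Suc j) w - Y j w\<bar> powr p)"
  proof eventually_elim
    case (elim w)
    then have "Y N w = - Y 0 w" by simp
    then show ?case
      unfolding c_def C_def by (rule discrete_Wirtinger[OF p \<rho> \<theta> N, of "\<lambda>j. Y j w"])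
  qed
  then have "(\<integral>\<^sup>+ w. ennreal (c * (\<Sum>j<N. \<bar>Y j w\<bar> powr p)) \<partial>M)
      \<le> (\<integral>\<^sup>+ w. ennreal (C * (\<Sum>j<N. \<bar>Y (Suc j) w - Y j w\<bar> powr p)) \<partial>M)"
    by (intro nn_integral_mono_AE) (auto elim!: eventually_mono intro: ennreal_leI)
  then have "ennreal (c * (\<Sum>j<N. Lp_norm p M (Y j) powr p))
      \<le> ennreal (C * (\<Sum>j<N. Lp_norm p M (\<lambda>w. Y (Suc j) w - Y j w) powr p))"
    by (simp add: int[OF Y cC(1)] int[OF Lp_diff(1)[OF p Y Y] cC(2)])
  then show ?thesis
    using cC by (simp add: c_def C_def sum_nonneg ennreal_le_iff)
qed

text \<open>On a grid of step \<open>S / N\<close>, the Wirtinger inequality bounds the increments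
  from below and the differential inequality bounds them from above by the same sum
  \<open>A > 0\<close>. Dividing by \<open>A\<close> and refining the grid leaves
  \<open>\<rho> \<le> S * L\<close> for each admissible \<open>\<rho>\<close>.\<close>

lemma antiperiodic_Lp_bound:
  fixes y v :: "real \<Rightarrow> 'a \<Rightarrow> real"
  assumes p: "1 < p" and y: "\<And>t. y t \<in> Lp_set p M" and v: "\<And>t. v t \<in> Lp_set p M"
    and der: "\<And>t. Lp_has_derivative p M y (v t) t"
    and vy: "\<And>t. Lp_norm p M (v t) \<le> L * Lp_norm p M (y t)"
    and L: "0 \<le> L" and S: "0 < S"
    and anti: "\<And>t. Lp_norm p M (\<lambda>w. y (t + S) w + y t w) = 0"
    and nz: "Lp_norm p M (y t0) \<noteq> 0"
  shows "1 / (2 * Cp p) \<le> S * L"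
proof -
  have grid: "\<rho> powr p * (1 - \<theta>) powr (p - 1)
      \<le> (1 + (\<rho> / N) powr p * \<theta> powr (1 - p)) * (S * L / (1 - S * L / N)) powr p"
    if \<rho>: "0 < \<rho>" "\<rho> < 1 / (2 * Cp p)" and \<theta>: "0 < \<theta>" "\<theta> < 1" and N: "0 < N" "S * L < real N"
    for \<rho> \<theta> :: real and N :: nat
  proof -
    define h where "h = S / N"
    define Y where "Y j = y (t0 + real j * h)" for j
    define A where "A = (\<Sum>j<N. Lp_norm p M (Y j) powr p)"
    define C where "C = 1 + (\<rho> / N) powr p * \<theta> powr (1 - p)"
    define K where "K = h * L / (1 - h * L)"
    have C: "0 \<le> C" by (simp add: C_def)
    have h: "0 \<le> h" "h * L < 1" using S N by (auto simp: h_def)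
    have K: "0 \<le> K" using h L by (simp add: K_def)
    have YN: "Y N = y (t0 + S)" "Y 0 = y t0" using N by (auto simp: Y_def h_def)
    have "0 < Lp_norm p M (Y 0) powr p" using nz by (simp add: YN)
    also have "\<dots> \<le> A"
      unfolding A_def using N by (intro member_le_sum) auto
    finally have A: "0 < A" .
    have inc: "Lp_norm p M (\<lambda>w. Y (Suc j) w - Y j w) powr p \<le> K powr p * Lp_norm p M (Y j) powr p" for j
    proof -
      have "Lp_norm p M (\<lambda>w. y (t0 + real j * h + h) w - y (t0 + real j * h) w)
          \<le> K * Lp_norm p M (y (t0 + real j * h))"
        unfolding K_def by (rule Lp_increment_le[OF p y v der vy L h])
      then have "Lp_norm p M (\<lambda>w. Y (Suc j) w - Y j w) \<le> K * Lp_norm p M (Y j)"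
        by (simp add: Y_def algebra_simps)
      then have "Lp_norm p M (\<lambda>w. Y (Suc j) w - Y j w) powr p \<le> (K * Lp_norm p M (Y j)) powr p"
        using p by (intro powr_mono2) auto
      then show ?thesis using K by (simp add: powr_mult)
    qed
    have "(\<rho> / N) powr p * (1 - \<theta>) powr (p - 1) * A
        \<le> C * (\<Sum>j<N. Lp_norm p M (\<lambda>w. Y (Suc j) w - Y j w) powr p)"
      unfolding A_def C_def
      by (rule Lp_sum_discrete_Wirtinger[OF p \<rho> \<theta> N(1)]) (use y anti in \<open>auto simp: YN, auto simp: Y_def\<close>)
    also have "\<dots> \<le> C * (K powr p * A)"
      unfolding A_def sum_distrib_left[of "K powr p"] using C by (intro mult_left_mono sum_mono inc)
    finally have "(\<rho> / N) powr p * (1 - \<theta>) powr (p - 1) \<le> C * K powr p"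
      using A by (simp flip: mult.assoc)
    \<comment> \<open>Both sides are of order \<open>N powr (- p)\<close>; rescaling gives finite
      limits as \<open>N\<close> grows.\<close>
    then have "real N powr p * ((\<rho> / N) powr p * (1 - \<theta>) powr (p - 1)) \<le> real N powr p * (C * K powr p)"
      by (intro mult_left_mono) auto
    also have "\<dots> = C * (real N * K) powr p"
      using K by (simp add: powr_mult)
    also have "real N * K = S * L / (1 - S * L / N)"
      using N by (simp add: K_def h_def)
    also have "real N powr p * ((\<rho> / N) powr p * (1 - \<theta>) powr (p - 1)) = \<rho> powr p * (1 - \<theta>) powr (p - 1)"
      using N \<rho> by (simp add: powr_divide)
    finally show ?thesis unfolding C_def .
  qed
  \<comment> \<open>The limit in \<open>N\<close> comes first: for fixed \<open>\<theta>\<close> it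
    removes the cost \<open>\<theta> powr (1 - p)\<close>, which would blow up as
    \<open>\<theta>\<close> tends to 0.\<close>
  have fine: "\<rho> powr p * (1 - \<theta>) powr (p - 1) \<le> (S * L) powr p"
    if \<rho>: "0 < \<rho>" "\<rho> < 1 / (2 * Cp p)" and \<theta>: "0 < \<theta>" "\<theta> < 1" for \<rho> \<theta> :: real
  proof -
    have SL: "0 \<le> S * L" using S L by simp
    have ev: "\<forall>\<^sub>F N in sequentially. 0 < N \<and> S * L < real N"
      using eventually_gt_at_top[of "nat \<lceil>S * L\<rceil>"]
      by eventually_elim linarith
    have lim1: "(\<lambda>N. (\<rho> / real N) powr p) \<longlonglongrightarrow> 0 powr p"
      using p \<rho> by (intro tendsto_powr' tendsto_const lim_const_over_n) auto
    have lim2: "(\<lambda>N. S * L / (1 - S * L / real N)) \<longlonglongrightarrow> S * L / (1 - 0)"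
      by (intro tendsto_intros lim_const_over_n) auto
    have "\<forall>\<^sub>F N in sequentially. 0 \<le> S * L / (1 - S * L / real N)"
      using ev by eventually_elim (use SL in auto)
    with lim2 have lim3: "(\<lambda>N. (S * L / (1 - S * L / real N)) powr p) \<longlonglongrightarrow> (S * L / (1 - 0)) powr p"
      using p by (intro tendsto_powr' tendsto_const) auto
    have "(\<lambda>N. (1 + (\<rho> / real N) powr p * \<theta> powr (1 - p)) * (S * L / (1 - S * L / real N)) powr p)
        \<longlonglongrightarrow> (1 + 0 powr p * \<theta> powr (1 - p)) * (S * L / (1 - 0)) powr p"
      by (intro tendsto_intros lim1 lim3)
    then have "(\<lambda>N. (1 + (\<rho> / real N) powr p * \<theta> powr (1 - p)) * (S * L / (1 - S * L / real N)) powr p)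
        \<longlonglongrightarrow> (S * L) powr p"
      by simp
    then show ?thesis
      by (rule tendsto_lowerbound) (use ev in \<open>auto elim!: eventually_mono intro: grid[OF that]\<close>)
  qed
  show ?thesis
  proof (rule dense_le_bounded[of 0])
    show "0 < 1 / (2 * Cp p)" using Cp_pos[OF p] by simp
    fix \<rho> assume \<rho>: "0 < \<rho>" "\<rho> < 1 / (2 * Cp p)"
    have "((\<lambda>\<theta>. \<rho> powr p * (1 - \<theta>) powr (p - 1)) \<longlongrightarrow> \<rho> powr p * (1 - 0) powr (p - 1)) (at_right 0)"
      by (intro tendsto_intros) auto
    then have lim: "((\<lambda>\<theta>. \<rho> powr p * (1 - \<theta>) powr (p - 1)) \<longlongrightarrow> \<rho> powr p) (at_right 0)" by simp
    have "\<forall>\<^sub>F \<theta> in at_right (0::real). \<theta> \<in> {0<..<1}"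
      by (rule eventually_at_right_real) simp
    then have "\<forall>\<^sub>F \<theta> in at_right 0. \<rho> powr p * (1 - \<theta>) powr (p - 1) \<le> (S * L) powr p"
      by eventually_elim (auto intro: fine[OF \<rho>])
    from tendsto_upperbound[OF lim this] have "\<rho> powr p \<le> (S * L) powr p" by simp
    then show "\<rho> \<le> S * L"
      using p S L powr_less_mono2[of p "S * L" \<rho>] by (cases "\<rho> \<le> S * L") auto
  qed
qed

section \<open>From periodic to antiperiodic curves\<close>

text \<open>The remainder of the difference quotient is the difference of the remainders of
  \<open>x\<close> at \<open>t + S\<close> and at \<open>t\<close>.\<close>

lemma Lp_has_derivative_shift_diff:
  assumes p: "1 < p" and x: "\<And>t. x t \<in> Lp_set p M" and v: "\<And>t. v t \<in> Lp_set p M"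
    and der: "\<And>t. Lp_has_derivative p M x (v t) t"
  shows "Lp_has_derivative p M (\<lambda>t w. x (t + S) w - x t w) (\<lambda>w. v (t + S) w - v t w) t"
proof -
  define r where "r t h w = (x (t + h) w - x t w) / h - v t w" for t h w
  have r: "r t h \<in> Lp_set p M" for t h
  proof -
    have "(\<lambda>w. (1 / h) * (x (t + h) w - x t w)) \<in> Lp_set p M"
      using p x by (intro Lp_cmult Lp_diff) auto
    then show ?thesis
      using Lp_diff(1)[OF p _ v] by (simp add: r_def [abs_def])
  qed
  have lim: "((\<lambda>h. Lp_norm p M (r t h)) \<longlongrightarrow> 0) (at 0)" for t
    using der[of t] by (simp add: Lp_has_derivative_def r_def [abs_def])
  have eq: "(x (t + h + S) w - x (t + h) w - (x (t + S) w - x t w)) / h - (v (t + S) w - v t w)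
      = r (t + S) h w - r t h w" for h w
    by (simp add: r_def add_ac diff_divide_distrib)
  have sum: "((\<lambda>h. Lp_norm p M (r (t + S) h) + Lp_norm p M (r t h)) \<longlongrightarrow> 0) (at 0)"
    using tendsto_add[OF lim[of "t + S"] lim[of t]] by simp
  show ?thesis
    unfolding Lp_has_derivative_def eq
    by (rule Lim_null_comparison[OF _ sum]) (simp add: Lp_norm_triangle_diff[OF p r r])
qed

lemma Lp_periodic_orbit_bound:
  fixes x :: "real \<Rightarrow> 'a \<Rightarrow> real"
  assumes p: "1 < p" and lip: "Lp_lipschitz p M f L" and T: "0 < T"
    and x: "\<And>t. x t \<in> Lp_set p M"
    and der: "\<And>t. Lp_has_derivative p M x (f (x t)) t"
    and per: "\<And>t. Lp_norm p M (\<lambda>w. x (t + T) w - x t w) = 0"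
    and nonconst: "Lp_norm p M (\<lambda>w. x s w - x t w) \<noteq> 0"
  shows "1 / Cp p \<le> T * L"
proof -
  have fx: "f (x t) \<in> Lp_set p M" for t
    using lip x by (auto simp: Lp_lipschitz_def)
  have flip: "Lp_norm p M (\<lambda>w. f (x s) w - f (x t) w) \<le> L * Lp_norm p M (\<lambda>w. x s w - x t w)" for s t
    using lip x by (auto simp: Lp_lipschitz_def)
  \<comment> \<open>The sign of \<open>L\<close> is forced by the Lipschitz bound at two points of
    the orbit with positive distance.\<close>
  have L: "0 \<le> L"
  proof -
    have "0 < Lp_norm p M (\<lambda>w. x s w - x t w)" using nonconst by (simp add: order_less_le)
    moreover have "0 \<le> L * Lp_norm p M (\<lambda>w. x s w - x t w)"
      using flip[of s t] order_trans[OF Lp_norm_nonneg] by blast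
    ultimately show ?thesis by (simp add: zero_le_mult_iff)
  qed
  define P where "P k \<longleftrightarrow> (\<forall>t. Lp_norm p M (\<lambda>w. x (t + T / 2 ^ k) w - x t w) = 0)" for k :: nat
  have "\<exists>k. \<not> P k"
  proof (rule ccontr)
    assume "\<nexists>k. \<not> P k"
    then have P: "Lp_norm p M (\<lambda>w. x (t + T / 2 ^ k) w - x t w) = 0" for k t
      by (auto simp: P_def)
    have stationary: "Lp_norm p M (f (x t)) = 0" for t
    proof -
      \<comment> \<open>Along these steps all difference quotients vanish in seminorm, so the
        derivative \<open>f (x t)\<close> does too.\<close>
      define h where "h k = T / 2 ^ k" for k :: nat
      have h0: "h k \<noteq> 0" for k using T by (simp add: h_def)
      have "(\<lambda>k. T * (1 / 2) ^ k) \<longlonglongrightarrow> T * 0"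
        by (intro tendsto_intros LIMSEQ_realpow_zero) auto
      then have "h \<longlonglongrightarrow> 0" by (simp add: h_def [abs_def] power_divide)
      then have "filterlim h (at 0) sequentially"
        using h0 by (simp add: filterlim_at)
      from filterlim_compose[OF der[of t, unfolded Lp_has_derivative_def] this]
      have lim: "(\<lambda>k. Lp_norm p M (\<lambda>w. (x (t + h k) w - x t w) / h k - f (x t) w)) \<longlonglongrightarrow> 0" .
      have "Lp_norm p M (f (x t)) \<le> Lp_norm p M (\<lambda>w. (x (t + h k) w - x t w) / h k - f (x t) w)" for k
      proof -
        let ?d = "\<lambda>w. (1 / h k) * (x (t + h k) w - x t w)"
        have d: "?d \<in> Lp_set p M" "Lp_norm p M ?d = \<bar>1 / h k\<bar> * Lp_norm p M (\<lambda>w. x (t + h k) w - x t w)"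
          using p by (intro Lp_cmult Lp_diff x; simp)+
        then have "Lp_norm p M ?d = 0" using P[of t k] by (simp add: h_def)
        with Lp_norm_le_add_dist[OF p fx d(1), of t] show ?thesis
          by (simp add: Lp_norm_minus_commute[of p M "f (x t)"])
      qed
      then have "Lp_norm p M (f (x t)) \<le> 0"
        by (intro tendsto_lowerbound[OF lim]) auto
      then show ?thesis by (simp add: order_antisym)
    qed
    have "Lp_norm p M (\<lambda>w. x b w - x a w) = 0" if "a \<le> b" for a b
    proof -
      have "Lp_norm p M (\<lambda>w. x b w - x a w) \<le> (b - a) * 0"
        by (rule Lp_mean_value_inequality[OF p x fx der that]) (simp add: stationary)
      then show ?thesis by (simp add: order_antisym)
    qed
    from this[of s t] this[of t s] nonconst show False
      by (metis Lp_norm_minus_commute linear)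
  qed
  \<comment> \<open>Minimality of \<open>k\<close> makes \<open>T / 2 ^ (k - 1)\<close>, which is
    \<open>2 * S\<close>, a period while \<open>S\<close> is not. Hence
    \<open>y (t + S) + y t\<close>, which is \<open>x (t + 2 * S) - x t\<close>, vanishes in
    seminorm, but \<open>y\<close> does not vanish identically.\<close>
  then obtain k where k: "\<not> P k" "\<And>j. j < k \<Longrightarrow> P j"
    using exists_least_iff[of "\<lambda>k. \<not> P k"] by blast
  have "P 0" using per by (simp add: P_def)
  then obtain j where j: "k = Suc j" using k(1) by (cases k) auto
  define S where "S = T / 2 ^ k"
  have S: "0 < S" "S + S = T / 2 ^ j" using T by (auto simp: S_def j)
  define y where "y t w = x (t + S) w - x t w" for t w
  define v where "v t w = f (x (t + S)) w - f (x t) w" for t w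
  obtain t0 where t0: "Lp_norm p M (y t0) \<noteq> 0"
    using k(1) by (auto simp: P_def y_def [abs_def] S_def)
  have "1 / (2 * Cp p) \<le> S * L"
  proof (rule antiperiodic_Lp_bound[where y = y and v = v and M = M and ?t0.0 = t0, OF p _ _ _ _ L S(1)])
    show "y t \<in> Lp_set p M" "v t \<in> Lp_set p M" for t
      unfolding y_def [abs_def] v_def [abs_def] by (intro Lp_diff p x fx)+
    show "Lp_has_derivative p M y (v t) t" for t
      unfolding y_def [abs_def] v_def [abs_def] by (rule Lp_has_derivative_shift_diff[OF p x fx der])
    show "Lp_norm p M (v t) \<le> L * Lp_norm p M (y t)" for t
      unfolding y_def [abs_def] v_def [abs_def] by (rule flip)
    show "Lp_norm p M (\<lambda>w. y (t + S) w + y t w) = 0" for t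
      using k(2)[of j] by (simp add: P_def y_def j add.assoc S(2))
  qed (rule t0)
  \<comment> \<open>Here \<open>k \<ge> 1\<close> enters, with equality for
    \<open>k = 1\<close>.\<close>
  also have "S * L \<le> T / 2 * L"
    unfolding S_def using T L by (intro mult_right_mono divide_left_mono) (auto simp: j)
  finally show ?thesis by simp
qed

section \<open>The finite-dimensional case as counting measure\<close>

lemma ellp_norm_eq_Lp_norm: "ellp_norm p v = Lp_norm p (count_space UNIV) (\<lambda>i. v $ i)"
  by (simp add: ellp_norm_def Lp_norm_def nn_integral_count_space_finite sum_nonneg)

lemma Lp_set_count_space_finite: "(u :: 'n::finite \<Rightarrow> real) \<in> Lp_set p (count_space UNIV)"
  by (simp add: Lp_set_def nn_integral_count_space_finite)

theorem theorem2:
  fixes p :: real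
  assumes "1 < p"
  shows
    "(\<forall>(f :: real ^ 'n \<Rightarrow> real ^ 'n) L T (x :: real \<Rightarrow> real ^ 'n).
        ellp_lipschitz p f L \<and> T > 0 \<and>
        (\<forall>t. ellp_has_derivative p x (f (x t)) t) \<and>
        (\<forall>t. x (t + T) = x t) \<and>
        (\<exists>s t. x s \<noteq> x t)
        \<longrightarrow> T * L \<ge> 1 / Cp p)
     \<and>
     (\<forall>(M :: 'a measure) f L T (x :: real \<Rightarrow> 'a \<Rightarrow> real).
        Lp_lipschitz p M f L \<and> T > 0 \<and>
        (\<forall>t. x t \<in> Lp_set p M) \<and>
        (\<forall>t. Lp_has_derivative p M x (f (x t)) t) \<and>
        (\<forall>t. Lp_norm p M (\<lambda>w. x (t + T) w - x t w) = 0) \<and>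
        (\<exists>s t. Lp_norm p M (\<lambda>w. x s w - x t w) \<noteq> 0)
        \<longrightarrow> T * L \<ge> 1 / Cp p)"
proof (intro conjI allI impI; elim conjE exE)
  fix f :: "real ^ 'n \<Rightarrow> real ^ 'n" and L T :: real and x :: "real \<Rightarrow> real ^ 'n" and s t
  assume lip: "ellp_lipschitz p f L" and T: "T > 0"
    and der: "\<forall>t. ellp_has_derivative p x (f (x t)) t"
    and per: "\<forall>t. x (t + T) = x t" and ne: "x s \<noteq> x t"
  let ?M = "count_space (UNIV :: 'n set)"
  \<comment> \<open>The vector field is transported to coordinate functions, so that the
    finite-dimensional claim becomes an instance of the one for \<open>Lp_set\<close>.\<close>
  let ?f = "\<lambda>u. vec_nth (f (vec_lambda u))"
  show "1 / Cp p \<le> T * L"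
  proof (rule Lp_periodic_orbit_bound[OF assms, where M = ?M and f = ?f and x = "\<lambda>t. vec_nth (x t)"
        and s = s and t = t])
    show "Lp_lipschitz p ?M ?f L"
      unfolding Lp_lipschitz_def
    proof (intro conjI ballI Lp_set_count_space_finite)
      fix u v :: "'n \<Rightarrow> real"
      show "Lp_norm p ?M (\<lambda>w. ?f u w - ?f v w) \<le> L * Lp_norm p ?M (\<lambda>w. u w - v w)"
        using lip[unfolded ellp_lipschitz_def, rule_format, of "vec_lambda u" "vec_lambda v"]
        by (simp add: ellp_norm_eq_Lp_norm)
    qed
    show "Lp_has_derivative p ?M (\<lambda>t. vec_nth (x t)) (?f (vec_nth (x t))) t" for t
      using der by (simp add: Lp_has_derivative_def ellp_has_derivative_def ellp_norm_eq_Lp_norm)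
    show "Lp_norm p ?M (\<lambda>w. x (t + T) $ w - x t $ w) = 0" for t
      using per assms by (simp add: Lp_norm_def)
    show "Lp_norm p ?M (\<lambda>w. x s $ w - x t $ w) \<noteq> 0"
    proof
      assume "Lp_norm p ?M (\<lambda>w. x s $ w - x t $ w) = 0"
      \<comment> \<open>Counting measure has only the empty null set, so distance 0 means equality
        of vectors.\<close>
      then have "AE w in ?M. x s $ w - x t $ w = 0"
        using assms by (intro Lp_norm_eq_0D[where p = p] Lp_set_count_space_finite) auto
      with ne show False by (simp add: AE_count_space vec_eq_iff)
    qed
  qed (use T Lp_set_count_space_finite in auto)
next
  fix M :: "'a measure" and f L T and x :: "real \<Rightarrow> 'a \<Rightarrow> real" and s t
  assume "Lp_lipschitz p M f L" "T > 0" "\<forall>t. x t \<in> Lp_set p M"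
    "\<forall>t. Lp_has_derivative p M x (f (x t)) t"
    "\<forall>t. Lp_norm p M (\<lambda>w. x (t + T) w - x t w) = 0"
    "Lp_norm p M (\<lambda>w. x s w - x t w) \<noteq> 0"
  then show "1 / Cp p \<le> T * L"
    using Lp_periodic_orbit_bound[OF assms, of M f L T x s t] by blast
qed

end
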